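(* Let $(q(x,y,t),n(x,y,t))$ be a smooth time-periodic solution to the flux-balanced Hasegawa-Wakatani (BHW) equations with $\mu=0$, that is, $$\partial_t q+J(\varphi,q)-\kappa\,\partial_y\varphi=0,\qquad \partial_t n+J(\varphi,n)+\kappa\,\partial_y\varphi=\alpha(\tilde\varphi-\tilde n),\qquad q=\nabla^2\varphi-\tilde n,$$ on a doubly-periodic domain. If $\nabla(q+\kappa x)\neq 0$ except possibly on a set of measure zero, then the Lagrangian flow of this solution, defined by $$\frac{dX}{dt}=u(X(t),Y(t),t),\qquad \frac{dY}{dt}=v(X(t),Y(t),t),\qquad (u,v)=(-\partial_y\varphi,\partial_x\varphi),$$ will be Liouville integrable.
   Context: The domain is $(x,y)\in[-L_x/2,L_x/2]\times[-L_y/2,L_y/2]$ with periodic boundary conditions in both variables. The constant $\kappa$ is the background density gradient, the constant $\alpha$ is the adiabaticity parameter, and $\mu$ is the diffusivity: the general BHW equations have the additional terms $\mu\nabla^2 q$ and $\mu\nabla^2 n$ on the right-hand sides of the $q$ and $n$ equations respectively, absent here since $\mu=0$. The function $\varphi$ is the electrostatic potential, $n$ is the density fluctuation, $q$ is the potential vorticity anomaly, and $q+\kappa x$ is the potential vorticity. Here $J(f,g)=\partial_x f\,\partial_y g-\partial_y f\,\partial_x g$, $\nabla=(\partial_x,\partial_y)$, and for a function $f$ the zonal mean is $\bar f=\frac1{L_y}\int f\,dy$ and $\tilde f=f-\bar f$. All functions are smooth. "Liouville integrable" is understood in the following generalized sense (which does not require a Hamiltonian structure). The Lagrangian flow is identified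 with the autonomous vector field (first-order differential operator) $D_t=\partial_t+u\,\partial_x+v\,\partial_y$ on the extended phase space with coordinates $(x,y,t)$, which includes time as a coordinate. A vector field $X_1$ on a manifold $M$ is integrable of type $(p,r)$, where $p\ge1$, $r\ge0$ and $p+r=\dim M$, if there exist $p$ vector fields $X_1,X_2,\dots,X_p$ and $r$ functions $F_1,\dots,F_r$ on $M$ such that: (1) the vector fields commute pairwise, $[X_i,X_j]=0$ for all $i,j$; (2) the functions are common integrals of motion, $X_i(F_j)=0$ for all $i,j$; (3) $X_1,\dots,X_p$ are linearly independent at all points of $M$ except possibly on a set of measure zero; (4) $\nabla F_1,\dots,\nabla F_r$ are linearly independent at all points of $M$ except possibly on a set of measure zero (in (4), $\nabla$ denotes the gradient on $M$). The Lagrangian flow is Liouville integrable if $D_t$ is integrable of some type $(p,r)$. *)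

theory Defs
  imports "HOL-Analysis.Analysis"
begin

section \<open>Smooth maps and partial derivatives\<close>

primrec Ck :: "nat \<Rightarrow> ('a::euclidean_space \<Rightarrow> 'b::real_normed_vector) \<Rightarrow> bool" where
  "Ck 0 f \<longleftrightarrow> continuous_on UNIV f"
| "Ck (Suc k) f \<longleftrightarrow> (\<forall>z. f differentiable (at z)) \<and>
                    (\<forall>v. Ck k (\<lambda>z. frechet_derivative f (at z) v))"

definition smooth :: "('a::euclidean_space \<Rightarrow> 'b::real_normed_vector) \<Rightarrow> bool" where
  "smooth f \<longleftrightarrow> (\<forall>k. Ck k f)"

definition grad :: "('a::euclidean_space \<Rightarrow> real) \<Rightarrow> 'a \<Rightarrow> 'a" where
  "grad F z = (\<Sum>b\<in>Basis. frechet_derivative F (at z) b *\<^sub>R b)"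


section \<open>Integrability of type (p, r)\<close>

text \<open>
  The manifolds considered are the quotients of a Euclidean space by the lattice generated
  by a set \<open>P\<close> of linearly independent periods (flat tori and cylinders; \<open>P = {}\<close> gives
  Euclidean space itself). Functions and vector fields on such a quotient are represented by
  their \<open>P\<close>-periodic lifts. A subset of the quotient has measure zero iff its preimage is
  negligible.
\<close>

definition periodic_wrt :: "'a::euclidean_space set \<Rightarrow> ('a \<Rightarrow> 'b) \<Rightarrow> bool" where
  "periodic_wrt P f \<longleftrightarrow> (\<forall>w\<in>P. \<forall>z. f (z + w) = f z)"

definition smooth_fun_on_quotient :: "'a::euclidean_space set \<Rightarrow> ('a \<Rightarrow> real) \<Rightarrow> bool" where
  "smooth_fun_on_quotient P F \<longleftrightarrow> smooth F \<and> periodic_wrt P F"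

definition vector_field_on_quotient :: "'a::euclidean_space set \<Rightarrow> ('a \<Rightarrow> 'a) \<Rightarrow> bool" where
  "vector_field_on_quotient P X \<longleftrightarrow> smooth X \<and> periodic_wrt P X"

definition apply_field :: "('a::euclidean_space \<Rightarrow> 'a) \<Rightarrow> ('a \<Rightarrow> real) \<Rightarrow> 'a \<Rightarrow> real" where
  "apply_field X F z = frechet_derivative F (at z) (X z)"

definition lie_bracket :: "('a::euclidean_space \<Rightarrow> 'a) \<Rightarrow> ('a \<Rightarrow> 'a) \<Rightarrow> 'a \<Rightarrow> 'a" where
  "lie_bracket X Y z = frechet_derivative Y (at z) (X z) - frechet_derivative X (at z) (Y z)"

definition lin_indep_family :: "'i set \<Rightarrow> ('i \<Rightarrow> 'a::real_vector) \<Rightarrow> bool" where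
  "lin_indep_family I w \<longleftrightarrow>
     (\<forall>c. (\<Sum>i\<in>I. c i *\<^sub>R w i) = 0 \<longrightarrow> (\<forall>i\<in>I. c i = 0))"

definition integrable_of_type ::
  "'a::euclidean_space set \<Rightarrow> nat \<Rightarrow> nat \<Rightarrow> ('a \<Rightarrow> 'a) \<Rightarrow> bool" where
  "integrable_of_type P p r V \<longleftrightarrow>
     p \<ge> 1 \<and> p + r = DIM('a) \<and>
     (\<exists>(X :: nat \<Rightarrow> 'a \<Rightarrow> 'a) (F :: nat \<Rightarrow> 'a \<Rightarrow> real).
        X 1 = V \<and>
        (\<forall>i\<in>{1..p}. vector_field_on_quotient P (X i)) \<and>
        (\<forall>j\<in>{1..r}. smooth_fun_on_quotient P (F j)) \<and>
        (\<forall>i\<in>{1..p}. \<forall>j\<in>{1..p}. \<forall>z. lie_bracket (X i) (X j) z = 0) \<and>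
        (\<forall>i\<in>{1..p}. \<forall>j\<in>{1..r}. \<forall>z. apply_field (X i) (F j) z = 0) \<and>
        negligible {z. \<not> lin_indep_family {1..p} (\<lambda>i. X i z)} \<and>
        negligible {z. \<not> lin_indep_family {1..r} (\<lambda>j. grad (F j) z)})"

definition liouville_integrable :: "'a::euclidean_space set \<Rightarrow> ('a \<Rightarrow> 'a) \<Rightarrow> bool" where
  "liouville_integrable P V \<longleftrightarrow> (\<exists>p r. integrable_of_type P p r V)"


section \<open>The flux-balanced Hasegawa-Wakatani equations\<close>

text \<open>Points of \<open>real ^ 3\<close> are \<open>(x, y, t)\<close>, with components 1, 2, 3 in this order.\<close>

definition pd :: "3 \<Rightarrow> (real ^ 3 \<Rightarrow> real) \<Rightarrow> real ^ 3 \<Rightarrow> real" where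
  "pd i f z = frechet_derivative f (at z) (axis i 1)"

definition jacobian :: "(real ^ 3 \<Rightarrow> real) \<Rightarrow> (real ^ 3 \<Rightarrow> real) \<Rightarrow> real ^ 3 \<Rightarrow> real" where
  "jacobian f g z = pd 1 f z * pd 2 g z - pd 2 f z * pd 1 g z"

definition laplacian :: "(real ^ 3 \<Rightarrow> real) \<Rightarrow> real ^ 3 \<Rightarrow> real" where
  "laplacian f z = pd 1 (pd 1 f) z + pd 2 (pd 2 f) z"

definition zonal_mean :: "real \<Rightarrow> (real ^ 3 \<Rightarrow> real) \<Rightarrow> real ^ 3 \<Rightarrow> real" where
  "zonal_mean Ly f z = (1 / Ly) * integral {- Ly / 2 .. Ly / 2} (\<lambda>y. f (vector [z $ 1, y, z $ 3]))"

definition nonzonal :: "real \<Rightarrow> (real ^ 3 \<Rightarrow> real) \<Rightarrow> real ^ 3 \<Rightarrow> real" where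
  "nonzonal Ly f z = f z - zonal_mean Ly f z"

text \<open>
  \<open>\<mu>\<close> is the diffusivity. Periodic boundary conditions on the rectangle with sides \<open>Lx\<close> and
  \<open>Ly\<close> are expressed through the periodic extensions of the unknowns to the whole plane.
\<close>

definition bhw_solution ::
  "real \<Rightarrow> real \<Rightarrow> real \<Rightarrow> real \<Rightarrow> real \<Rightarrow>
   (real ^ 3 \<Rightarrow> real) \<Rightarrow> (real ^ 3 \<Rightarrow> real) \<Rightarrow> (real ^ 3 \<Rightarrow> real) \<Rightarrow> bool" where
  "bhw_solution \<kappa> \<alpha> \<mu> Lx Ly \<phi> q n \<longleftrightarrow>
     smooth \<phi> \<and> smooth q \<and> smooth n \<and>
     periodic_wrt {axis 1 Lx, axis 2 Ly} \<phi> \<and>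
     periodic_wrt {axis 1 Lx, axis 2 Ly} q \<and>
     periodic_wrt {axis 1 Lx, axis 2 Ly} n \<and>
     (\<forall>z. pd 3 q z + jacobian \<phi> q z - \<kappa> * pd 2 \<phi> z = \<mu> * laplacian q z) \<and>
     (\<forall>z. pd 3 n z + jacobian \<phi> n z + \<kappa> * pd 2 \<phi> z
            = \<alpha> * (nonzonal Ly \<phi> z - nonzonal Ly n z) + \<mu> * laplacian n z) \<and>
     (\<forall>z. q z = laplacian \<phi> z - nonzonal Ly n z)"

text \<open>
  The operator \<open>D\<^sub>t = \<partial>\<^sub>t + u \<partial>\<^sub>x + v \<partial>\<^sub>y\<close> with \<open>(u, v) = (- \<partial>\<^sub>y \<phi>, \<partial>\<^sub>x \<phi>)\<close>,
  as a vector field on the extended phase space.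
\<close>

definition lagrangian_field :: "(real ^ 3 \<Rightarrow> real) \<Rightarrow> real ^ 3 \<Rightarrow> real ^ 3" where
  "lagrangian_field \<phi> z = vector [- pd 2 \<phi> z, pd 1 \<phi> z, 1]"

definition potential_vorticity :: "real \<Rightarrow> (real ^ 3 \<Rightarrow> real) \<Rightarrow> real ^ 3 \<Rightarrow> real" where
  "potential_vorticity \<kappa> q z = q z + \<kappa> * z $ 1"

end

(* The potential vorticity Q = q + \<kappa> x is conserved along the flow, so at each time the field
   Y = -Q_y \<partial>_x + Q_x \<partial>_y generated by Q as a stream function commutes with D_t, and Q is a common
   integral of D_t and Y. This gives integrability of type (2, 1). Two corrections are needed to
   work on the three-torus: Q is replaced by sin (a Q + \<theta>), where a makes it periodic in x and \<theta> is
   chosen such that the critical levels of the sine have measure zero, which excludes only countably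
   many values; and the velocity is shown to be periodic in time because \<phi>(t + T) - \<phi>(t) is
   harmonic and doubly periodic. *)

theory Submission
  imports Defs "HOL-Complex_Analysis.Cauchy_Integral_Formula"
begin

section \<open>Smooth functions\<close>

text \<open>The recursion in \<open>Ck\<close> only speaks of derivatives, whereas the product and
  chain rules leave undifferentiated factors; this supplies the regularity of those factors in the
  inductions below.\<close>

lemma Ck_Suc_imp_Ck: "Ck (Suc k) f \<Longrightarrow> Ck k f"
proof (induction k arbitrary: f)
  case 0
  then show ?case
    by (simp add: continuous_at_imp_continuous_on differentiable_imp_continuous_within)
next
  case (Suc k)
  then show ?case
    by (subst Ck.simps) (auto simp del: Ck.simps simp: Ck.simps(2)[of "Suc k" f])
qed

lemma smooth_differentiable: "smooth f \<Longrightarrow> f differentiable (at z)"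
  unfolding smooth_def by (metis Ck.simps(2))

lemma smooth_has_derivative: "smooth f \<Longrightarrow> (f has_derivative frechet_derivative f (at z)) (at z)"
  using smooth_differentiable frechet_derivative_works by blast

lemma smooth_directional_derivative: "smooth f \<Longrightarrow> smooth (\<lambda>z. frechet_derivative f (at z) v)"
  unfolding smooth_def by (metis Ck.simps(2))

lemma smooth_continuous: "smooth f \<Longrightarrow> continuous_on UNIV f"
  unfolding smooth_def by (metis Ck.simps(1))

section \<open>Closure of smoothness under sums, linear maps, products, sine and cosine\<close>

lemma Ck_const: "Ck k (\<lambda>z. c)"
  by (induction k arbitrary: c) auto

lemma Ck_add: "Ck k f \<Longrightarrow> Ck k g \<Longrightarrow> Ck k (\<lambda>z. f z + g z)"
proof (induction k arbitrary: f g)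
  case 0
  then show ?case by (auto intro: continuous_on_add)
next
  case (Suc k)
  then have "f differentiable (at z)" "g differentiable (at z)" for z by auto
  then have "frechet_derivative (\<lambda>z. f z + g z) (at z) =
      (\<lambda>v. frechet_derivative f (at z) v + frechet_derivative g (at z) v)" for z
    by (intro frechet_derivative_at[symmetric] has_derivative_add) (simp_all add: frechet_derivative_works[symmetric])
  with Suc show ?case by auto
qed

lemma Ck_bounded_linear_compose: "bounded_linear L \<Longrightarrow> Ck k f \<Longrightarrow> Ck k (\<lambda>z. L (f z))"
proof (induction k arbitrary: f)
  case 0
  then show ?case by (auto intro: bounded_linear.continuous_on)
next
  case (Suc k)
  then have "f differentiable (at z)" for z by auto
  then have "((\<lambda>z. L (f z)) has_derivative (\<lambda>v. L (frechet_derivative f (at z) v))) (at z)" for z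
    by (intro bounded_linear.has_derivative[OF Suc.prems(1)]) (simp add: frechet_derivative_works[symmetric])
  then have "frechet_derivative (\<lambda>z. L (f z)) (at z) = (\<lambda>v. L (frechet_derivative f (at z) v))"
    "(\<lambda>z. L (f z)) differentiable (at z)" for z
    using frechet_derivative_at[symmetric] differentiableI by blast+
  with Suc show ?case by auto
qed

text \<open>A linear map is its own derivative at every point, so its directional derivatives are
  constants and no induction is required.\<close>

lemma Ck_bounded_linear: "bounded_linear L \<Longrightarrow> Ck k L"
proof (cases k)
  case 0
  assume "bounded_linear L"
  then show ?thesis
    using 0 by (simp add: linear_continuous_on)
next
  case (Suc j)
  assume L: "bounded_linear L"
  then have "frechet_derivative L (at z) = L" "L differentiable (at z)" for z
    using bounded_linear_imp_has_derivative frechet_derivative_at differentiableI by metis+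
  then show ?thesis by (auto simp: Suc Ck_const)
qed

lemma Ck_mult:
  fixes f g :: "'a::euclidean_space \<Rightarrow> real"
  shows "Ck k f \<Longrightarrow> Ck k g \<Longrightarrow> Ck k (\<lambda>z. f z * g z)"
proof (induction k arbitrary: f g)
  case 0
  then show ?case by (auto intro: continuous_on_mult)
next
  case (Suc k)
  then have "f differentiable (at z)" "g differentiable (at z)" for z by auto
  then have *: "frechet_derivative (\<lambda>z. f z * g z) (at z) =
      (\<lambda>v. f z * frechet_derivative g (at z) v + frechet_derivative f (at z) v * g z)" for z
    by (intro frechet_derivative_at[symmetric] has_derivative_mult) (simp_all add: frechet_derivative_works[symmetric])
  have "Ck k f" "Ck k g"
    using Suc.prems Ck_Suc_imp_Ck by blast+
  with Suc show ?case by (auto simp: * intro!: Ck_add)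
qed

text \<open>Differentiation exchanges sine and cosine, so neither half carries an induction
  alone.\<close>

lemma Ck_sin_cos:
  fixes f :: "'a::euclidean_space \<Rightarrow> real"
  shows "Ck k f \<Longrightarrow> Ck k (\<lambda>z. sin (f z)) \<and> Ck k (\<lambda>z. cos (f z))"
proof (induction k arbitrary: f)
  case 0
  then show ?case by (auto intro: continuous_on_sin continuous_on_cos)
next
  case (Suc k)
  then have d: "(f has_derivative frechet_derivative f (at z)) (at z)" for z
    using frechet_derivative_works by auto
  have s: "((\<lambda>z. sin (f z)) has_derivative (\<lambda>v. frechet_derivative f (at z) v * cos (f z))) (at z)" for z
    by (rule has_derivative_sin[OF d])
  have c: "((\<lambda>z. cos (f z)) has_derivative (\<lambda>v. frechet_derivative f (at z) v * - sin (f z))) (at z)" for z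
    by (rule has_derivative_cos[OF d])
  have ds: "frechet_derivative (\<lambda>z. sin (f z)) (at z) v = frechet_derivative f (at z) v * cos (f z)"
    and dc: "frechet_derivative (\<lambda>z. cos (f z)) (at z) v = frechet_derivative f (at z) v * - sin (f z)" for z v
    by (simp_all only: frechet_derivative_at[OF s, symmetric] frechet_derivative_at[OF c, symmetric])
  have k: "Ck k f"
    using Suc.prems Ck_Suc_imp_Ck by blast
  have "Ck k (\<lambda>z. - sin (f z))"
    using Ck_bounded_linear_compose[OF bounded_linear_minus[OF bounded_linear_ident], of k "\<lambda>z. sin (f z)"] Suc.IH[OF k] by simp
  then show ?case
    using Suc.IH[OF k] Suc.prems differentiableI[OF s] differentiableI[OF c]
    unfolding Ck.simps ds dc by (intro conjI allI Ck_mult) auto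
qed

lemma smooth_const: "smooth (\<lambda>z. c)"
  and smooth_add: "smooth f \<Longrightarrow> smooth g \<Longrightarrow> smooth (\<lambda>z. f z + g z)"
  and smooth_sin: "smooth h \<Longrightarrow> smooth (\<lambda>z. sin (h z :: real))"
  by (simp_all add: smooth_def Ck_const Ck_add Ck_sin_cos)

lemma smooth_bounded_linear_compose: "bounded_linear L \<Longrightarrow> smooth f \<Longrightarrow> smooth (\<lambda>z. L (f z))"
  by (simp add: smooth_def Ck_bounded_linear_compose)

lemma smooth_bounded_linear: "bounded_linear L \<Longrightarrow> smooth L"
  by (simp add: smooth_def Ck_bounded_linear)

lemma smooth_minus: "smooth f \<Longrightarrow> smooth (\<lambda>z. - f z)"
  using smooth_bounded_linear_compose[OF bounded_linear_minus[OF bounded_linear_ident]] by blast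

lemma smooth_diff: "smooth f \<Longrightarrow> smooth g \<Longrightarrow> smooth (\<lambda>z. f z - g z)"
  using smooth_add[OF _ smooth_minus, of f g] by simp

text \<open>The two functions have the same candidates for a derivative at the corresponding points,
  so the choice made by \<open>frechet_derivative\<close> is the same, even where no derivative
  exists.\<close>

lemma frechet_derivative_translate:
  "frechet_derivative (\<lambda>z. f (z + w)) (at z) = frechet_derivative f (at (z + w))"
proof -
  have "((\<lambda>z. f (z + w)) has_derivative D) (at z) \<longleftrightarrow> (f has_derivative D) (at (z + w))" for D
  proof
    assume D: "((\<lambda>z. f (z + w)) has_derivative D) (at z)"
    have "((\<lambda>y. y - w) has_derivative (\<lambda>h. h)) (at (z + w))"
      by (auto intro!: derivative_eq_intros)
    from has_derivative_compose[OF this, of "\<lambda>z. f (z + w)" D] D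
    show "(f has_derivative D) (at (z + w))" by simp
  next
    assume D: "(f has_derivative D) (at (z + w))"
    have "((\<lambda>y. y + w) has_derivative (\<lambda>h. h)) (at z)"
      by (auto intro!: derivative_eq_intros)
    from has_derivative_compose[OF this D]
    show "((\<lambda>z. f (z + w)) has_derivative D) (at z)" by simp
  qed
  then show ?thesis by (simp add: frechet_derivative_def)
qed

lemma Ck_translate: "Ck k f \<Longrightarrow> Ck k (\<lambda>z. f (z + w))"
proof (induction k arbitrary: f)
  case 0
  then show ?case by (auto intro!: continuous_on_compose2[of UNIV f] continuous_intros)
next
  case (Suc k)
  then have "(f has_derivative frechet_derivative f (at z)) (at z)" for z
    using frechet_derivative_works by auto
  then have "((\<lambda>z. f (z + w)) has_derivative frechet_derivative f (at (z + w))) (at z)" for z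
    by (rule has_derivative_compose[rotated]) (auto intro!: derivative_eq_intros)
  with Suc show ?case
    by (auto simp: frechet_derivative_translate intro: differentiableI)
qed

lemma smooth_translate: "smooth f \<Longrightarrow> smooth (\<lambda>z. f (z + w))"
  by (simp add: smooth_def Ck_translate)

section \<open>Mean value theorems and the symmetry of second derivatives\<close>

lemma directional_mvt:
  fixes f :: "'a::euclidean_space \<Rightarrow> real"
  assumes "smooth f" "h > 0"
  obtains s where "0 < s" "s < h"
    "f (z + h *\<^sub>R u) - f z = h * frechet_derivative f (at (z + s *\<^sub>R u)) u"
proof -
  have "((\<lambda>s. f (z + s *\<^sub>R u)) has_real_derivative frechet_derivative f (at (z + s *\<^sub>R u)) u) (at s)" for s
  proof -
    have "((\<lambda>s. z + s *\<^sub>R u) has_derivative (\<lambda>r. r *\<^sub>R u)) (at s)"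
      by (auto intro!: derivative_eq_intros)
    from has_derivative_compose[OF this smooth_has_derivative[OF assms(1)]]
    have "((\<lambda>s. f (z + s *\<^sub>R u)) has_derivative
        (\<lambda>r. frechet_derivative f (at (z + s *\<^sub>R u)) (r *\<^sub>R u))) (at s)" .
    moreover have "frechet_derivative f (at (z + s *\<^sub>R u)) (r *\<^sub>R u) =
        frechet_derivative f (at (z + s *\<^sub>R u)) u * r" for r
      using linear_frechet_derivative[OF smooth_differentiable[OF assms(1)]] by (simp add: linear_scale)
    ultimately show ?thesis by (simp add: has_field_derivative_def)
  qed
  then have "\<And>s. 0 \<le> s \<Longrightarrow> s \<le> h \<Longrightarrow>
      ((\<lambda>s. f (z + s *\<^sub>R u)) has_real_derivative frechet_derivative f (at (z + s *\<^sub>R u)) u) (at s)"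
    by blast
  from MVT2[OF assms(2) this] show ?thesis using that by auto
qed

text \<open>The second difference is the increment along \<open>u\<close> of the first difference
  \<open>g\<close> along \<open>v\<close>. The mean value theorem is applied to \<open>g\<close> in
  direction \<open>u\<close>, and then to the \<open>u\<close>-derivative of \<open>f\<close> in
  direction \<open>v\<close>.\<close>

lemma second_difference_mvt:
  fixes f :: "'a::euclidean_space \<Rightarrow> real"
  assumes "smooth f" "h > 0"
  obtains s r where "0 < s" "s < h" "0 < r" "r < h"
    "f (z + h *\<^sub>R u + h *\<^sub>R v) - f (z + h *\<^sub>R u) - f (z + h *\<^sub>R v) + f z =
     h * h * frechet_derivative (\<lambda>z. frechet_derivative f (at z) u) (at (z + s *\<^sub>R u + r *\<^sub>R v)) v"
proof -
  define g where "g = (\<lambda>z. f (z + h *\<^sub>R v) - f z)"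
  have g: "smooth g"
    unfolding g_def by (intro smooth_diff smooth_translate assms)
  from directional_mvt[OF g assms(2), of z u] obtain s where s: "0 < s" "s < h"
    "g (z + h *\<^sub>R u) - g z = h * frechet_derivative g (at (z + s *\<^sub>R u)) u" by blast
  have "frechet_derivative g (at p) = (\<lambda>u. frechet_derivative f (at (p + h *\<^sub>R v)) u - frechet_derivative f (at p) u)" for p
    unfolding g_def frechet_derivative_translate[symmetric]
    by (intro frechet_derivative_at[symmetric] has_derivative_diff smooth_has_derivative smooth_translate assms)
  moreover from directional_mvt[OF smooth_directional_derivative[OF assms(1)] assms(2), of "z + s *\<^sub>R u" v u]
  obtain r where "0 < r" "r < h"
    "frechet_derivative f (at (z + s *\<^sub>R u + h *\<^sub>R v)) u - frechet_derivative f (at (z + s *\<^sub>R u)) u =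
     h * frechet_derivative (\<lambda>z. frechet_derivative f (at z) u) (at (z + s *\<^sub>R u + r *\<^sub>R v)) v" by blast
  ultimately show ?thesis
    using s by (intro that[of s r]) (auto simp: g_def algebra_simps)
qed

text \<open>The second difference is symmetric in \<open>u\<close> and \<open>v\<close>. Evaluating
  it in both orders gives points near \<open>z\<close> at which the two mixed derivatives take equal
  values; continuity carries the equality to \<open>z\<close>.\<close>

lemma mixed_derivatives_commute:
  fixes f :: "'a::euclidean_space \<Rightarrow> real"
  assumes "smooth f"
  shows "frechet_derivative (\<lambda>z. frechet_derivative f (at z) u) (at z) v =
         frechet_derivative (\<lambda>z. frechet_derivative f (at z) v) (at z) u" (is "?L z = ?R z")
proof -
  have "\<exists>p p'. norm (p - z) \<le> h * (norm u + norm v) \<and> norm (p' - z) \<le> h * (norm u + norm v) \<and> ?L p = ?R p'"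
    if h: "h > 0" for h
  proof -
    obtain s r where 1: "0 < s" "s < h" "0 < r" "r < h"
      "f (z + h *\<^sub>R u + h *\<^sub>R v) - f (z + h *\<^sub>R u) - f (z + h *\<^sub>R v) + f z = h * h * ?L (z + s *\<^sub>R u + r *\<^sub>R v)"
      using second_difference_mvt[OF assms h, of z u v] by blast
    obtain s' r' where 2: "0 < s'" "s' < h" "0 < r'" "r' < h"
      "f (z + h *\<^sub>R v + h *\<^sub>R u) - f (z + h *\<^sub>R v) - f (z + h *\<^sub>R u) + f z = h * h * ?R (z + s' *\<^sub>R v + r' *\<^sub>R u)"
      using second_difference_mvt[OF assms h, of z v u] by blast
    have "h * h * ?L (z + s *\<^sub>R u + r *\<^sub>R v) = h * h * ?R (z + s' *\<^sub>R v + r' *\<^sub>R u)"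
      unfolding 1(5)[symmetric] 2(5)[symmetric] by (simp add: algebra_simps)
    then have eq: "?L (z + s *\<^sub>R u + r *\<^sub>R v) = ?R (z + s' *\<^sub>R v + r' *\<^sub>R u)"
      using h by simp
    have "norm (a *\<^sub>R x + b *\<^sub>R y) \<le> h * (norm x + norm y)"
      if "0 < a" "a < h" "0 < b" "b < h" for a b and x y :: 'a
    proof -
      have "norm (a *\<^sub>R x + b *\<^sub>R y) \<le> a * norm x + b * norm y"
        using norm_triangle_ineq[of "a *\<^sub>R x" "b *\<^sub>R y"] that by simp
      also have "\<dots> \<le> h * norm x + h * norm y"
        using that by (intro add_mono mult_right_mono) auto
      finally show ?thesis by (simp add: algebra_simps)
    qed
    from this[OF 1(1-4), of u v] this[OF 2(1-4), of v u]
    have "norm (z + s *\<^sub>R u + r *\<^sub>R v - z) \<le> h * (norm u + norm v)"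
      "norm (z + s' *\<^sub>R v + r' *\<^sub>R u - z) \<le> h * (norm u + norm v)"
      by (simp_all add: add.assoc add.commute[of "norm v"])
    with eq show ?thesis by blast
  qed
  \<comment> \<open>With \<open>h\<close> = 1 / (k + 1) the points of coincidence form sequences
    converging to \<open>z\<close>.\<close>
  then have "\<forall>k. \<exists>p p'. norm (p - z) \<le> 1 / real (Suc k) * (norm u + norm v) \<and>
      norm (p' - z) \<le> 1 / real (Suc k) * (norm u + norm v) \<and> ?L p = ?R p'"
    by (metis zero_less_divide_1_iff of_nat_0_less_iff zero_less_Suc)
  then obtain p p' where p: "\<And>k. norm (p k - z) \<le> 1 / real (Suc k) * (norm u + norm v)"
    "\<And>k. norm (p' k - z) \<le> 1 / real (Suc k) * (norm u + norm v)" "\<And>k. ?L (p k) = ?R (p' k)"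
    by metis
  have lim: "(\<lambda>k. 1 / real (Suc k) * (norm u + norm v)) \<longlonglongrightarrow> 0"
    by (intro tendsto_mult_left_zero LIMSEQ_Suc lim_1_over_n)
  have "(\<lambda>k. p k - z) \<longlonglongrightarrow> 0" "(\<lambda>k. p' k - z) \<longlonglongrightarrow> 0"
    by (rule Lim_null_comparison[OF always_eventually[OF allI] lim], rule p)+
  then have "p \<longlonglongrightarrow> z" "p' \<longlonglongrightarrow> z"
    by (simp_all only: LIM_zero_iff)
  moreover have "isCont ?L z" "isCont ?R z"
    using smooth_continuous[OF smooth_directional_derivative[OF smooth_directional_derivative[OF assms]]]
    by (auto simp: continuous_on_eq_continuous_at)
  ultimately have "(\<lambda>k. ?L (p k)) \<longlonglongrightarrow> ?L z" "(\<lambda>k. ?R (p' k)) \<longlonglongrightarrow> ?R z"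
    by (auto intro: isCont_tendsto_compose)
  then show ?thesis
    using p(3) LIMSEQ_unique by auto
qed


section \<open>Periodic functions\<close>

lemma periodic_wrt_insert:
  "periodic_wrt (insert w P) f \<longleftrightarrow> (\<forall>z. f (z + w) = f z) \<and> periodic_wrt P f"
  by (auto simp: periodic_wrt_def)

lemma periodic_wrt_empty: "periodic_wrt {} f"
  by (simp add: periodic_wrt_def)

lemma frechet_derivative_periodic:
  assumes "\<forall>z. f (z + w) = f z"
  shows "frechet_derivative f (at (z + w)) = frechet_derivative f (at z)"
  using assms by (simp flip: frechet_derivative_translate)

lemma periodic_int_multiple:
  fixes w :: "'a::real_vector"
  assumes "\<forall>z. f (z + w) = f z"
  shows "f (z + of_int k *\<^sub>R w) = f z"
proof (induction k rule: int_induct[where k = 0])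
  case base
  show ?case by simp
next
  case (step1 i)
  then show ?case
    using assms[rule_format, of "z + of_int i *\<^sub>R w"] by (simp add: algebra_simps)
next
  case (step2 i)
  then show ?case
    using assms[rule_format, of "z + of_int (i - 1) *\<^sub>R w"] by (simp add: algebra_simps)
qed

lemma reduce_to_period:
  fixes x L :: real
  assumes "L > 0"
  obtains k :: int where "x + of_int k * L \<in> {0..L}"
proof -
  have "of_int \<lfloor>x / L\<rfloor> * L \<le> x" "x \<le> (of_int \<lfloor>x / L\<rfloor> + 1) * L"
    using assms by (simp_all add: pos_le_divide_eq[symmetric] pos_divide_le_eq[symmetric])
  then show ?thesis
    by (intro that[of "- \<lfloor>x / L\<rfloor>"]) (simp add: algebra_simps)
qed

text \<open>With a triple written as a combination of fixed vectors, the rules for sums and scalar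
  multiples yield its continuity, smoothness and derivatives.\<close>

lemma vector_3_eq_sum_axis:
  "(vector [a, b, c] :: real ^ 3) = a *\<^sub>R axis 1 1 + b *\<^sub>R axis 2 1 + c *\<^sub>R axis 3 1"
  by (simp add: vec_eq_iff forall_3 axis_def)

lemma axis_eq_scaleR: "(axis i c :: real ^ 3) = c *\<^sub>R axis i 1"
  by (simp add: vec_eq_iff axis_def)

lemma continuous_on_vector_3:
  fixes a b c :: "'a::t2_space \<Rightarrow> real"
  assumes "continuous_on S a" "continuous_on S b" "continuous_on S c"
  shows "continuous_on S (\<lambda>s. vector [a s, b s, c s] :: real ^ 3)"
  unfolding vector_3_eq_sum_axis by (intro continuous_intros assms)

text \<open>At a fixed time, a continuous function is bounded on the compact rectangle of one
  period, and integer multiples of the periods bring every point there. This supplies the bound for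
  Liouville's theorem.\<close>

lemma doubly_periodic_bounded:
  fixes f :: "real ^ 3 \<Rightarrow> real"
  assumes "continuous_on UNIV f" "periodic_wrt {axis 1 Lx, axis 2 Ly} f" "Lx > 0" "Ly > 0"
  obtains B where "\<And>x y. \<bar>f (vector [x, y, t])\<bar> \<le> B"
proof -
  have p: "\<forall>z. f (z + axis 1 Lx) = f z" "\<forall>z. f (z + axis 2 Ly) = f z"
    using assms(2) by (simp_all add: periodic_wrt_insert)
  have "compact ((\<lambda>p. f (vector [fst p, snd p, t])) ` ({0..Lx} \<times> {0..Ly}))"
    by (intro compact_continuous_image compact_Times compact_Icc continuous_on_compose2[OF assms(1)]
        continuous_on_vector_3 continuous_intros) auto
  from compact_imp_bounded[OF this] obtain B where
    B: "\<And>x y. x \<in> {0..Lx} \<Longrightarrow> y \<in> {0..Ly} \<Longrightarrow> \<bar>f (vector [x, y, t])\<bar> \<le> B"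
    unfolding bounded_iff by fastforce
  show ?thesis
  proof
    fix x y
    obtain k l :: int where "x + of_int k * Lx \<in> {0..Lx}" "y + of_int l * Ly \<in> {0..Ly}"
      using reduce_to_period assms by metis
    note B[OF this]
    moreover have "vector [x + of_int k * Lx, y + of_int l * Ly, t] =
        (vector [x, y, t] + of_int k *\<^sub>R axis 1 Lx + of_int l *\<^sub>R axis 2 Ly :: real ^ 3)"
      by (simp add: vec_eq_iff forall_3 axis_def)
    ultimately show "\<bar>f (vector [x, y, t])\<bar> \<le> B"
      by (simp add: periodic_int_multiple[OF p(1)] periodic_int_multiple[OF p(2)])
  qed
qed


section \<open>Calculus in the coordinates $(x, y, t)$\<close>

lemma smooth_pd: "smooth f \<Longrightarrow> smooth (pd i f)"
  unfolding pd_def[abs_def] by (rule smooth_directional_derivative)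

lemma pd_periodic: "\<forall>z. f (z + w) = f z \<Longrightarrow> pd i f (z + w) = pd i f z"
  by (simp add: pd_def frechet_derivative_periodic)

lemma periodic_wrt_pd: "periodic_wrt P f \<Longrightarrow> periodic_wrt P (pd i f)"
  by (simp add: periodic_wrt_def pd_periodic)

lemma pd_commute: "smooth f \<Longrightarrow> pd i (pd j f) z = pd j (pd i f) z"
  unfolding pd_def[abs_def] by (rule mixed_derivatives_commute)

lemma frechet_derivative_eq_pd:
  assumes "f differentiable (at z)"
  shows "frechet_derivative f (at z) (vector [a, b, c]) = a * pd 1 f z + b * pd 2 f z + c * pd 3 f z"
  unfolding vector_3_eq_sum_axis pd_def
  using linear_frechet_derivative[OF assms] by (simp add: linear_add linear_scale)

lemma pd_unique: "(f has_derivative D) (at z) \<Longrightarrow> pd i f z = D (axis i 1)"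
  by (simp add: pd_def frechet_derivative_at[symmetric])

lemma pd_diff:
  "smooth f \<Longrightarrow> smooth g \<Longrightarrow> pd i (\<lambda>z. f z - g z) z = pd i f z - pd i g z"
  unfolding pd_def[of _ f] pd_def[of _ g]
  by (rule pd_unique) (intro has_derivative_diff smooth_has_derivative)

lemma pd_minus: "smooth f \<Longrightarrow> pd i (\<lambda>z. - f z) z = - pd i f z"
  unfolding pd_def[of _ f]
  by (rule pd_unique) (intro has_derivative_minus smooth_has_derivative)

lemma pd_translate: "pd i (\<lambda>z. f (z + w)) z = pd i f (z + w)"
  by (simp add: pd_def frechet_derivative_translate)

lemma smooth_vector_3:
  fixes a b c :: "'a::euclidean_space \<Rightarrow> real"
  assumes "smooth a" "smooth b" "smooth c"
  shows "smooth (\<lambda>z. vector [a z, b z, c z] :: real ^ 3)"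
  unfolding vector_3_eq_sum_axis
  using smooth_bounded_linear_compose[OF bounded_linear_scaleR_left] assms
  by (intro smooth_add) auto

lemma frechet_derivative_vector_3:
  fixes a b c :: "'a::euclidean_space \<Rightarrow> real"
  assumes "smooth a" "smooth b" "smooth c"
  shows "frechet_derivative (\<lambda>z. vector [a z, b z, c z] :: real ^ 3) (at z) v =
    vector [frechet_derivative a (at z) v, frechet_derivative b (at z) v, frechet_derivative c (at z) v]"
  unfolding vector_3_eq_sum_axis
  by (rule fun_cong[OF frechet_derivative_at[symmetric]])
    (intro has_derivative_add bounded_linear.has_derivative[OF bounded_linear_scaleR_left]
      smooth_has_derivative assms)

lemma laplacian_diff:
  assumes "smooth f" "smooth g"
  shows "laplacian (\<lambda>z. f z - g z) z = laplacian f z - laplacian g z"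
proof -
  have "pd i (\<lambda>z. f z - g z) = (\<lambda>z. pd i f z - pd i g z)" for i
    by (rule ext) (rule pd_diff[OF assms])
  then show ?thesis
    by (simp add: laplacian_def pd_diff smooth_pd assms)
qed

lemma laplacian_translate: "laplacian (\<lambda>z. f (z + w)) z = laplacian f (z + w)"
proof -
  have "pd i (\<lambda>z. f (z + w)) = (\<lambda>z. pd i f (z + w))" for i
    by (rule ext) (rule pd_translate)
  then show ?thesis
    by (simp add: laplacian_def pd_translate)
qed

text \<open>Rolle's theorem over one period. It shows that a constant partial derivative of a
  periodic function is zero.\<close>

lemma periodic_pd_vanishes:
  assumes "smooth f" "\<forall>z. f (z + axis i L) = f z" "L > 0"
  obtains s where "pd i f (z + axis i s) = 0"
proof -
  obtain s where "f (z + L *\<^sub>R axis i 1) - f z = L * frechet_derivative f (at (z + s *\<^sub>R axis i 1)) (axis i 1)"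
    using directional_mvt[OF assms(1,3), of z "axis i 1"] by blast
  then show ?thesis
    using assms that[of s] by (simp add: pd_def axis_eq_scaleR[of i L] axis_eq_scaleR[of i s])
qed

text \<open>The function \<open>\<psi>\<^sub>x - i \<psi>\<^sub>y\<close> of \<open>x + i y\<close> is entire and bounded, hence constant by Liouville's
  theorem; the constant is zero because \<open>\<psi>\<close> takes equal values at the ends of each period.\<close>

lemma doubly_periodic_harmonic_gradient:
  assumes \<psi>: "smooth \<psi>" and per: "periodic_wrt {axis 1 Lx, axis 2 Ly} \<psi>" and L: "Lx > 0" "Ly > 0"
    and harm: "\<And>z. laplacian \<psi> z = 0"
  shows "pd 1 \<psi> z = 0" "pd 2 \<psi> z = 0"
proof -
  \<comment> \<open>Time is frozen: \<open>E\<close> identifies the complex plane with the slice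
    through \<open>z\<close>.\<close>
  define t where "t = z $ 3"
  define E where "E = (\<lambda>w. vector [Re w, Im w, t] :: real ^ 3)"
  define g where "g = (\<lambda>w. Complex (pd 1 \<psi> (E w)) (- pd 2 \<psi> (E w)))"
  have E: "(E has_derivative (\<lambda>h. vector [Re h, Im h, 0])) (at w)" for w
    unfolding E_def vector_3_eq_sum_axis by (auto intro!: derivative_eq_intros)
  have "(g has_field_derivative Complex (pd 1 (pd 1 \<psi>) (E w)) (- pd 2 (pd 1 \<psi>) (E w))) (at w)" for w
  proof -
    have D: "((\<lambda>w. pd i \<psi> (E w)) has_derivative
        (\<lambda>h. Re h * pd 1 (pd i \<psi>) (E w) + Im h * pd 2 (pd i \<psi>) (E w))) (at w)" for i
      using has_derivative_compose[OF E smooth_has_derivative[OF smooth_pd[OF \<psi>]]]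
      by (simp add: frechet_derivative_eq_pd smooth_differentiable smooth_pd \<psi>)
    \<comment> \<open>Harmonicity and the symmetry of mixed derivatives are the Cauchy-Riemann
      equations for \<open>g\<close>; they turn its real derivative into multiplication by a complex
      number.\<close>
    have c: "pd 2 (pd 2 \<psi>) (E w) = - pd 1 (pd 1 \<psi>) (E w)" "pd 1 (pd 2 \<psi>) (E w) = pd 2 (pd 1 \<psi>) (E w)"
      using harm[of "E w"] pd_commute[OF \<psi>] by (simp_all add: laplacian_def)
    have "g = (\<lambda>w. of_real (pd 1 \<psi> (E w)) - \<i> * of_real (pd 2 \<psi> (E w)))"
      by (auto simp: g_def complex_eq_iff)
    moreover have "((\<lambda>w. of_real (pd 1 \<psi> (E w)) - \<i> * of_real (pd 2 \<psi> (E w))) has_derivative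
      (\<lambda>h. of_real (Re h * pd 1 (pd 1 \<psi>) (E w) + Im h * pd 2 (pd 1 \<psi>) (E w)) -
        \<i> * of_real (Re h * pd 1 (pd 2 \<psi>) (E w) + Im h * pd 2 (pd 2 \<psi>) (E w)))) (at w)"
      by (intro has_derivative_diff has_derivative_mult_right has_derivative_of_real D)
    ultimately show ?thesis
      unfolding has_field_derivative_def
      by (rule_tac has_derivative_eq_rhs, simp) (auto simp: c complex_eq_iff algebra_simps)
  qed
  then have "g holomorphic_on UNIV"
    by (auto simp: holomorphic_on_def field_differentiable_def)
  moreover have "bounded (range g)"
  proof -
    obtain B where B: "\<And>x y. \<bar>pd 1 \<psi> (vector [x, y, t])\<bar> \<le> B"
      using doubly_periodic_bounded[OF smooth_continuous[OF smooth_pd[OF \<psi>]] periodic_wrt_pd[OF per] L] by blast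
    obtain C where C: "\<And>x y. \<bar>pd 2 \<psi> (vector [x, y, t])\<bar> \<le> C"
      using doubly_periodic_bounded[OF smooth_continuous[OF smooth_pd[OF \<psi>]] periodic_wrt_pd[OF per] L] by blast
    have "norm (g w) \<le> B + C" for w
      using cmod_le[of "g w"] B[of "Re w" "Im w"] C[of "Re w" "Im w"] by (simp add: g_def E_def)
    then show ?thesis by (auto simp: bounded_iff)
  qed
  ultimately obtain c where "\<And>w. g w = c"
    using Liouville_theorem by (auto simp: constant_on_def)
  then have c: "pd 1 \<psi> (E w) = Re c" "pd 2 \<psi> (E w) = - Im c" for w
    unfolding g_def by (metis complex.sel(1), metis complex.sel(2) minus_minus)
  have z: "z = E (Complex (z $ 1) (z $ 2))"
    by (simp add: E_def t_def vec_eq_iff forall_3)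
  have p: "\<forall>z. \<psi> (z + axis 1 Lx) = \<psi> z" "\<forall>z. \<psi> (z + axis 2 Ly) = \<psi> z"
    using per by (simp_all add: periodic_wrt_insert)
  obtain s where "pd 1 \<psi> (z + axis 1 s) = 0"
    using periodic_pd_vanishes[OF \<psi> p(1) L(1)] by blast
  moreover have "z + axis 1 s = E (Complex (z $ 1 + s) (z $ 2))"
    by (simp add: E_def t_def vec_eq_iff forall_3 axis_def)
  ultimately show "pd 1 \<psi> z = 0"
    using c(1) z by metis
  obtain r where "pd 2 \<psi> (z + axis 2 r) = 0"
    using periodic_pd_vanishes[OF \<psi> p(2) L(2)] by blast
  moreover have "z + axis 2 r = E (Complex (z $ 1) (z $ 2 + r))"
    by (simp add: E_def t_def vec_eq_iff forall_3 axis_def)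
  ultimately show "pd 2 \<psi> z = 0"
    using c(2) z by metis
qed


section \<open>Level sets\<close>

text \<open>Level sets are disjoint, so only countably many can have positive measure within a ball,
  and countably many balls exhaust the space.\<close>

lemma countable_nonnegligible_levels:
  fixes f :: "'a::euclidean_space \<Rightarrow> real"
  assumes "continuous_on UNIV f"
  shows "countable {c. \<not> negligible {z. f z = c}}"
proof -
  \<comment> \<open>The image under \<open>f\<close> of Lebesgue measure on the ball of radius
    \<open>k\<close>: a finite measure, whose atoms are the values that \<open>f\<close> takes on a
    part of the ball with positive measure.\<close>
  define M where "M = (\<lambda>k::nat. distr (restrict_space lborel (cball 0 (real k))) borel f)"
  have f: "f \<in> borel_measurable borel"
    using assms by (rule borel_measurable_continuous_onI)
  have fin: "finite_measure (M k)" for k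
  proof -
    interpret finite_measure "restrict_space lborel (cball (0::'a) (real k))"
      using emeasure_lborel_cball_finite[of "0 :: 'a" "real k"]
      by (intro finite_measureI) (simp add: space_restrict_space emeasure_restrict_space)
    show ?thesis
      unfolding M_def by (intro finite_measure_distr measurable_restrict_space1) (use f in simp)
  qed
  have "c \<in> (\<Union>k. {c. measure (M k) {c} \<noteq> 0})" if c: "\<not> negligible {z. f z = c}" for c
  proof (rule ccontr)
    assume *: "c \<notin> (\<Union>k. {c. measure (M k) {c} \<noteq> 0})"
    have "negligible ({z. f z = c} \<inter> cball 0 (real k))" for k
    proof -
      interpret finite_measure "M k" by (rule fin)
      have m: "{z. f z = c} \<in> sets borel"
        using measurable_sets[OF f, of "{c}"] by (simp add: vimage_def)
      have "f \<in> restrict_space lborel (cball 0 (real k)) \<rightarrow>\<^sub>M borel"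
        using f by (intro measurable_restrict_space1) simp
      then have "emeasure (M k) {c} = emeasure (restrict_space lborel (cball 0 (real k)))
          (f -` {c} \<inter> space (restrict_space lborel (cball 0 (real k))))"
        unfolding M_def by (intro emeasure_distr) auto
      also have "f -` {c} \<inter> space (restrict_space lborel (cball 0 (real k))) = {z. f z = c} \<inter> cball 0 (real k)"
        by (auto simp: space_restrict_space)
      also have "emeasure (restrict_space lborel (cball 0 (real k))) \<dots> = emeasure lborel \<dots>"
        by (intro emeasure_restrict_space) auto
      finally have "emeasure lborel ({z. f z = c} \<inter> cball 0 (real k)) = 0"
        using * by (simp add: emeasure_eq_measure)
      then show ?thesis
        using m by (intro negligible_iff_null_sets[THEN iffD2] null_setsI) auto
    qed
    then have "negligible (\<Union>k. {z. f z = c} \<inter> cball 0 (real k))"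
      by (intro negligible_countable_Union) auto
    moreover have "(\<Union>k. {z. f z = c} \<inter> cball 0 (real k)) = {z. f z = c}"
      using real_arch_simple by auto
    ultimately show False using c by simp
  qed
  moreover have "countable (\<Union>k. {c. measure (M k) {c} \<noteq> 0})"
    using finite_measure.countable_support[OF fin] by auto
  ultimately show ?thesis
    by (blast intro: countable_subset)
qed

lemma exists_phase_with_negligible_critical_levels:
  fixes f :: "'a::euclidean_space \<Rightarrow> real"
  assumes "continuous_on UNIV f"
  obtains \<theta> where "negligible {z. cos (f z + \<theta>) = 0}"
proof -
  let ?bad = "{c. \<not> negligible {z. f z = c}}"
  \<comment> \<open>A phase is excluded when some k pi/2 - \<theta> is a level of positive measure.
    All integers k are treated alike, although the zeros of the cosine are only the odd multiples of
    pi/2.\<close>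
  have "countable (\<Union>k::int. (\<lambda>c. of_int k * (pi / 2) - c) ` ?bad)"
    using countable_nonnegligible_levels[OF assms] by auto
  then obtain \<theta> where \<theta>: "\<theta> \<notin> (\<Union>k::int. (\<lambda>c. of_int k * (pi / 2) - c) ` ?bad)"
    using uncountable_UNIV_real by (metis UNIV_eq_I)
  have "negligible {z. f z = of_int k * (pi / 2) - \<theta>}" for k :: int
  proof (rule ccontr)
    assume "\<not> negligible {z. f z = of_int k * (pi / 2) - \<theta>}"
    then have "of_int k * (pi / 2) - (of_int k * (pi / 2) - \<theta>) \<in> (\<lambda>c. of_int k * (pi / 2) - c) ` ?bad"
      by (intro imageI) simp
    then show False using \<theta> by auto
  qed
  then have "negligible (\<Union>k::int. {z. f z = of_int k * (pi / 2) - \<theta>})"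
    by (intro negligible_countable_Union) auto
  then show ?thesis
    by (rule that[OF negligible_subset]) (auto simp: cos_zero_iff_int algebra_simps)
qed


section \<open>The Lagrangian flow\<close>

text \<open>At each fixed time, \<open>Q\<close> generates the incompressible flow that it is itself the stream
  function of. Since the map from stream functions to such fields is a Lie algebra homomorphism,
  the bracket with \<open>D\<^sub>t\<close> is the field generated by \<open>D\<^sub>t Q\<close>.\<close>

definition hamiltonian_field :: "(real ^ 3 \<Rightarrow> real) \<Rightarrow> real ^ 3 \<Rightarrow> real ^ 3" where
  "hamiltonian_field Q z = vector [- pd 2 Q z, pd 1 Q z, 0]"

lemma smooth_lagrangian_field: "smooth \<phi> \<Longrightarrow> smooth (lagrangian_field \<phi>)"
  unfolding lagrangian_field_def[abs_def]
  by (intro smooth_vector_3 smooth_minus smooth_pd smooth_const)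

lemma smooth_hamiltonian_field: "smooth Q \<Longrightarrow> smooth (hamiltonian_field Q)"
  unfolding hamiltonian_field_def[abs_def]
  by (intro smooth_vector_3 smooth_minus smooth_pd smooth_const)

lemma apply_lagrangian_field:
  assumes "smooth F"
  shows "apply_field (lagrangian_field \<phi>) F z = pd 3 F z + jacobian \<phi> F z"
  by (simp add: apply_field_def lagrangian_field_def frechet_derivative_eq_pd
      smooth_differentiable[OF assms] jacobian_def)

lemma apply_hamiltonian_field:
  assumes "smooth F"
  shows "apply_field (hamiltonian_field Q) F z = jacobian Q F z"
  by (simp add: apply_field_def hamiltonian_field_def frechet_derivative_eq_pd
      smooth_differentiable[OF assms] jacobian_def)

text \<open>The Leibniz rule for D_t Q. The cases \<open>i\<close> = 1 and \<open>i\<close> = 2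
  give, up to sign, the components of the Lie bracket below.\<close>

lemma pd_material_derivative:
  assumes "smooth \<phi>" "smooth Q"
  shows "pd i (\<lambda>z. pd 3 Q z + jacobian \<phi> Q z) z =
    pd i (pd 3 Q) z + pd i (pd 1 \<phi>) z * pd 2 Q z + pd 1 \<phi> z * pd i (pd 2 Q) z
    - pd i (pd 2 \<phi>) z * pd 1 Q z - pd 2 \<phi> z * pd i (pd 1 Q) z"
proof -
  have d: "(pd j f has_derivative frechet_derivative (pd j f) (at z)) (at z)" if "smooth f" for j f
    using that by (intro smooth_has_derivative smooth_pd)
  have "((\<lambda>z. pd 3 Q z + jacobian \<phi> Q z) has_derivative
      (\<lambda>v. frechet_derivative (pd 3 Q) (at z) v
        + ((pd 1 \<phi> z * frechet_derivative (pd 2 Q) (at z) v + frechet_derivative (pd 1 \<phi>) (at z) v * pd 2 Q z)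
        - (pd 2 \<phi> z * frechet_derivative (pd 1 Q) (at z) v + frechet_derivative (pd 2 \<phi>) (at z) v * pd 1 Q z)))) (at z)"
    unfolding jacobian_def by (intro has_derivative_add has_derivative_diff has_derivative_mult d assms)
  from pd_unique[OF this] show ?thesis
    by (simp add: pd_def[of i "pd _ _"])
qed

lemma lie_bracket_lagrangian_hamiltonian:
  assumes "smooth \<phi>" "smooth Q" and inv: "\<And>z. pd 3 Q z + jacobian \<phi> Q z = 0"
  shows "lie_bracket (lagrangian_field \<phi>) (hamiltonian_field Q) z = 0"
proof -
  have 0: "pd i (\<lambda>z. pd 3 Q z + jacobian \<phi> Q z) z = 0" for i
    unfolding inv by (simp add: pd_def)
  \<comment> \<open>An identity for arbitrary smooth \<phi> and \<open>Q\<close>, by commuting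
    partial derivatives; conservation of \<open>Q\<close> enters only afterwards.\<close>
  have "lie_bracket (lagrangian_field \<phi>) (hamiltonian_field Q) z =
    vector [- pd 2 (\<lambda>z. pd 3 Q z + jacobian \<phi> Q z) z, pd 1 (\<lambda>z. pd 3 Q z + jacobian \<phi> Q z) z, 0]"
    unfolding lie_bracket_def pd_material_derivative[OF assms(1,2)]
    unfolding lagrangian_field_def[abs_def] hamiltonian_field_def[abs_def]
    by (simp add: frechet_derivative_vector_3 smooth_minus smooth_pd smooth_const assms(1,2) pd_minus
        frechet_derivative_eq_pd smooth_differentiable vec_eq_iff forall_3
        pd_commute[OF assms(1), of 2 1] pd_commute[OF assms(2), of 2 1]
        pd_commute[OF assms(2), of 3 1] pd_commute[OF assms(2), of 3 2] algebra_simps)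
  then show ?thesis
    unfolding 0 by (simp add: vec_eq_iff forall_3)
qed

text \<open>The time components are 1 and 0, which forces \<open>c 1 = 0\<close>; the nonzero
  horizontal gradient then forces \<open>c 2 = 0\<close>.\<close>

lemma lin_indep_lagrangian_hamiltonian:
  assumes "(pd 1 Q z, pd 2 Q z) \<noteq> (0, 0)"
  shows "lin_indep_family {1..2::nat} (\<lambda>i. (if i = 1 then lagrangian_field \<phi> else hamiltonian_field Q) z)"
proof -
  have "c 1 = 0 \<and> c 2 = 0"
    if "c 1 *\<^sub>R lagrangian_field \<phi> z + c 2 *\<^sub>R hamiltonian_field Q z = 0" for c :: "nat \<Rightarrow> real"
    using that assms by (auto simp: lagrangian_field_def hamiltonian_field_def vec_eq_iff forall_3)
  moreover have "{1..2} = {1, 2::nat}" by auto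
  ultimately show ?thesis
    by (simp add: lin_indep_family_def)
qed

section \<open>Conservation of potential vorticity and periodicity in time\<close>

lemma smooth_potential_vorticity: "smooth q \<Longrightarrow> smooth (potential_vorticity \<kappa> q)"
  unfolding potential_vorticity_def[abs_def]
  by (intro smooth_add smooth_bounded_linear[OF bounded_linear_const_mult] bounded_linear_vec_nth)

text \<open>The linear term contributes only a constant, so the derivatives of the potential
  vorticity keep the periods of \<open>q\<close>, while the potential vorticity itself gains
  \<kappa> Lx over a period in x.\<close>

lemma pd_potential_vorticity:
  assumes "smooth q"
  shows "pd i (potential_vorticity \<kappa> q) z = pd i q z + \<kappa> * axis i 1 $ 1"
proof -
  have "(potential_vorticity \<kappa> q has_derivative
      (\<lambda>v. frechet_derivative q (at z) v + \<kappa> * v $ 1)) (at z)"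
    unfolding potential_vorticity_def[abs_def]
    by (intro has_derivative_add smooth_has_derivative assms has_derivative_mult_right
        bounded_linear_imp_has_derivative bounded_linear_vec_nth)
  from pd_unique[OF this] show ?thesis by (simp add: pd_def)
qed

text \<open>The term -\<kappa> \<phi>_y in the equation for \<open>q\<close> is exactly J(\<phi>,
  \<kappa> x), so without diffusion it is absorbed into the transport of q + \<kappa> x.\<close>

lemma potential_vorticity_conserved:
  assumes "bhw_solution \<kappa> \<alpha> 0 Lx Ly \<phi> q n"
  shows "pd 3 (potential_vorticity \<kappa> q) z + jacobian \<phi> (potential_vorticity \<kappa> q) z = 0"
proof -
  have "smooth q" "pd 3 q z + jacobian \<phi> q z - \<kappa> * pd 2 \<phi> z = 0"
    using assms by (simp_all add: bhw_solution_def)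
  then show ?thesis
    by (simp add: jacobian_def pd_potential_vorticity axis_def algebra_simps)
qed

text \<open>Averaging over y commutes with shifts in time. The nonzonal part of \<open>n\<close> is
  a source in the Poisson equation for \<phi>.\<close>

lemma nonzonal_periodic_in_time:
  assumes "\<forall>z. n (z + axis 3 T) = n z"
  shows "nonzonal Ly n (z + axis 3 T) = nonzonal Ly n z"
proof -
  have "vector [(z + axis 3 T) $ 1, y, (z + axis 3 T) $ 3] = (vector [z $ 1, y, z $ 3] + axis 3 T :: real ^ 3)" for y
    by (simp add: vec_eq_iff forall_3 axis_def)
  then show ?thesis
    unfolding nonzonal_def zonal_mean_def using assms by simp
qed

text \<open>The potential itself need not be time-periodic: the equations determine it only up to
  a function of time.\<close>

lemma velocity_periodic_in_time:
  assumes "Lx > 0" "Ly > 0" and sol: "bhw_solution \<kappa> \<alpha> \<mu> Lx Ly \<phi> q n"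
    and q: "\<forall>z. q (z + axis 3 T) = q z" and n: "\<forall>z. n (z + axis 3 T) = n z"
  shows "pd 1 \<phi> (z + axis 3 T) = pd 1 \<phi> z" "pd 2 \<phi> (z + axis 3 T) = pd 2 \<phi> z"
proof -
  define \<psi> where "\<psi> = (\<lambda>z. \<phi> (z + axis 3 T) - \<phi> z)"
  have \<phi>: "smooth \<phi>" "\<forall>z. \<phi> (z + axis 1 Lx) = \<phi> z" "\<forall>z. \<phi> (z + axis 2 Ly) = \<phi> z"
    and lap: "\<And>z. laplacian \<phi> z = q z + nonzonal Ly n z"
    using sol by (simp_all add: bhw_solution_def periodic_wrt_insert)
  have s: "smooth (\<lambda>z. \<phi> (z + axis 3 T))"
    by (rule smooth_translate[OF \<phi>(1)])
  have \<psi>: "smooth \<psi>"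
    unfolding \<psi>_def by (intro smooth_diff s \<phi>)
  have "\<phi> (z + w + axis 3 T) = \<phi> (z + axis 3 T)" if "\<forall>z. \<phi> (z + w) = \<phi> z" for z w
    using that[rule_format, of "z + axis 3 T"] by (simp add: add_ac)
  then have per: "periodic_wrt {axis 1 Lx, axis 2 Ly} \<psi>"
    using \<phi> by (simp add: periodic_wrt_insert periodic_wrt_empty \<psi>_def)
  \<comment> \<open>The source of the Poisson equation for \<phi> is the same at times t and t +
    T.\<close>
  have "laplacian \<psi> z = 0" for z
    unfolding \<psi>_def
    by (simp add: laplacian_diff[OF s \<phi>(1)] laplacian_translate lap q nonzonal_periodic_in_time[OF n])
  from doubly_periodic_harmonic_gradient[OF \<psi> per assms(1,2) this, of z]
  have "pd 1 \<psi> z = 0" "pd 2 \<psi> z = 0" by auto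
  then show "pd 1 \<phi> (z + axis 3 T) = pd 1 \<phi> z" "pd 2 \<phi> (z + axis 3 T) = pd 2 \<phi> z"
    unfolding \<psi>_def by (simp_all add: pd_diff[OF s \<phi>(1)] pd_translate)
qed

text \<open>The gradient of the sine is a scalar multiple of that of \<open>Q\<close>. Hence fields
  annihilating \<open>Q\<close> annihilate it too, and for nonzero \<open>a\<close> new critical
  points arise only at zeros of the cosine.\<close>

lemma frechet_derivative_sin_affine:
  fixes Q :: "'a::euclidean_space \<Rightarrow> real"
  assumes "smooth Q"
  shows "frechet_derivative (\<lambda>z. sin (a * Q z + \<theta>)) (at z) v =
    a * cos (a * Q z + \<theta>) * frechet_derivative Q (at z) v"
proof -
  have "((\<lambda>z. a * Q z + \<theta>) has_derivative (\<lambda>v. a * frechet_derivative Q (at z) v)) (at z)"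
    by (intro has_derivative_add_const has_derivative_mult_right smooth_has_derivative assms)
  from has_derivative_sin[OF this] have "((\<lambda>z. sin (a * Q z + \<theta>)) has_derivative
      (\<lambda>v. a * cos (a * Q z + \<theta>) * frechet_derivative Q (at z) v)) (at z)"
    by (simp add: mult.commute mult.left_commute)
  then show ?thesis
    by (simp add: frechet_derivative_at[symmetric])
qed

section \<open>Integrability of type (2, 1) on the three-torus\<close>

theorem mainTheorem2:
  fixes \<kappa> \<alpha> Lx Ly T :: real and \<phi> q n :: "real ^ 3 \<Rightarrow> real"
  assumes "Lx > 0" and "Ly > 0" and "T > 0"
    and "bhw_solution \<kappa> \<alpha> 0 Lx Ly \<phi> q n"
    and "periodic_wrt {axis 3 T} q" and "periodic_wrt {axis 3 T} n"
    and "negligible {z. (pd 1 (potential_vorticity \<kappa> q) z, pd 2 (potential_vorticity \<kappa> q) z) = (0, 0)}"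
  shows "liouville_integrable {axis 1 Lx, axis 2 Ly, axis 3 T} (lagrangian_field \<phi>)"
proof -
  let ?P = "{axis 1 Lx, axis 2 Ly, axis 3 T} :: (real ^ 3) set"
  define Q where "Q = potential_vorticity \<kappa> q"
  have \<phi>: "smooth \<phi>" "periodic_wrt {axis 1 Lx, axis 2 Ly} \<phi>"
    and q: "smooth q" "periodic_wrt {axis 1 Lx, axis 2 Ly} q"
    using assms(4) by (simp_all add: bhw_solution_def)
  have qT: "\<forall>z. q (z + axis 3 T) = q z" and nT: "\<forall>z. n (z + axis 3 T) = n z"
    using assms(5,6) by (simp_all add: periodic_wrt_insert)
  have Q: "smooth Q"
    unfolding Q_def by (rule smooth_potential_vorticity[OF q(1)])
  have inv: "pd 3 Q z + jacobian \<phi> Q z = 0" for z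
    unfolding Q_def by (rule potential_vorticity_conserved[OF assms(4)])
  have crit: "negligible {z. (pd 1 Q z, pd 2 Q z) = (0, 0)}"
    using assms(7) by (simp add: Q_def)

  have "periodic_wrt ?P (pd 1 \<phi>)" "periodic_wrt ?P (pd 2 \<phi>)"
    using periodic_wrt_pd[OF \<phi>(2)] velocity_periodic_in_time[OF assms(1,2,4) qT nT]
    by (simp_all add: periodic_wrt_insert)
  then have X1: "vector_field_on_quotient ?P (lagrangian_field \<phi>)"
    by (simp add: vector_field_on_quotient_def smooth_lagrangian_field \<phi> lagrangian_field_def periodic_wrt_def)
  have "periodic_wrt ?P q"
    using q(2) qT by (simp add: periodic_wrt_insert)
  from periodic_wrt_pd[OF this] have X2: "vector_field_on_quotient ?P (hamiltonian_field Q)"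
    by (simp add: vector_field_on_quotient_def smooth_hamiltonian_field[OF Q])
      (simp add: hamiltonian_field_def Q_def pd_potential_vorticity q periodic_wrt_def)

  \<comment> \<open>Over a period in x, \<open>Q\<close> gains \<kappa> Lx, which this factor
    rescales to 2 pi. For \<kappa> = 0 there is no gain, and 1 serves as a nonzero factor.\<close>
  define a where "a = (if \<kappa> = 0 then 1 else 2 * pi / (\<kappa> * Lx))"
  have a: "a \<noteq> 0" "a * (\<kappa> * Lx) = 0 \<or> a * (\<kappa> * Lx) = 2 * pi"
    using assms(1) by (auto simp: a_def)
  obtain \<theta> where \<theta>: "negligible {z. cos (a * Q z + \<theta>) = 0}"
    by (rule exists_phase_with_negligible_critical_levels[of "\<lambda>z. a * Q z"])
      (intro continuous_on_mult_left smooth_continuous Q)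
  define F where "F = (\<lambda>z. sin (a * Q z + \<theta>))"
  have "smooth F"
    unfolding F_def
    by (intro smooth_sin smooth_add smooth_const smooth_bounded_linear_compose[OF bounded_linear_mult_right] Q)
  \<comment> \<open>Among the three periods only \<open>axis 1 Lx\<close> has a nonzero first
    component, so the phase gains 0 or 2 pi.\<close>
  have F_shift: "F (z + w) = F z"
    if "q (z + w) = q z" "a * (\<kappa> * w $ 1) = 0 \<or> a * (\<kappa> * w $ 1) = 2 * pi" for z w
  proof -
    have "a * Q (z + w) + \<theta> = (a * Q z + \<theta>) + a * (\<kappa> * w $ 1)"
      using that(1) by (simp add: Q_def potential_vorticity_def algebra_simps)
    then show ?thesis
      unfolding F_def using that(2) by (elim disjE) (simp_all only: add_0_right sin_periodic)
  qed
  have "periodic_wrt ?P F"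
    using q(2) qT a(2) by (auto simp: periodic_wrt_insert periodic_wrt_empty axis_def intro!: F_shift)
  with \<open>smooth F\<close> have F: "smooth_fun_on_quotient ?P F"
    by (simp add: smooth_fun_on_quotient_def)
  have pdF: "pd i F z = a * cos (a * Q z + \<theta>) * pd i Q z" for i z
    unfolding pd_def F_def by (rule frechet_derivative_sin_affine[OF Q])
  have F1: "apply_field (lagrangian_field \<phi>) F z = 0" for z
  proof -
    have "apply_field (lagrangian_field \<phi>) F z = a * cos (a * Q z + \<theta>) * (pd 3 Q z + jacobian \<phi> Q z)"
      by (simp add: apply_lagrangian_field \<open>smooth F\<close> jacobian_def pdF algebra_simps)
    then show ?thesis by (simp add: inv)
  qed
  \<comment> \<open>\<open>F\<close> is a function of \<open>Q\<close>, so J(Q, F) cancels.\<close>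
  have F2: "apply_field (hamiltonian_field Q) F z = 0" for z
    by (simp add: apply_hamiltonian_field \<open>smooth F\<close> jacobian_def pdF)

  have grad: "lin_indep_family {1..1::nat} (\<lambda>j. grad F z)"
    if "cos (a * Q z + \<theta>) \<noteq> 0" "(pd 1 Q z, pd 2 Q z) \<noteq> (0, 0)" for z
  proof -
    \<comment> \<open>A nonzero x or y component already makes the gradient nonzero, which is
      independence for a family of one vector.\<close>
    have "grad F z \<bullet> axis i 1 = pd i F z" for i
      unfolding grad_def pd_def by (rule inner_sum_left_Basis) simp
    then have "grad F z \<noteq> 0"
      using that a by (auto simp: pdF)
    then show ?thesis by (simp add: lin_indep_family_def)
  qed
  have indep_F: "negligible {z. \<not> lin_indep_family {1..1::nat} (\<lambda>j. grad F z)}"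
    by (rule negligible_subset[OF negligible_Un[OF \<theta> crit]]) (use grad in auto)
  define X where "X = (\<lambda>i::nat. if i = 1 then lagrangian_field \<phi> else hamiltonian_field Q)"
  have indep_X: "negligible {z. \<not> lin_indep_family {1..2} (\<lambda>i. X i z)}"
    unfolding X_def
    by (rule negligible_subset[OF crit]) (use lin_indep_lagrangian_hamiltonian in blast)
  have bracket: "lie_bracket (lagrangian_field \<phi>) (hamiltonian_field Q) z = 0" for z
    by (rule lie_bracket_lagrangian_hamiltonian[OF \<phi>(1) Q inv])
  moreover have "lie_bracket (hamiltonian_field Q) (lagrangian_field \<phi>) z = 0" for z
    using bracket[of z] by (simp add: lie_bracket_def)
  moreover have "lie_bracket Y Y z = 0" for Y :: "real ^ 3 \<Rightarrow> real ^ 3" and z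
    by (simp add: lie_bracket_def)
  ultimately have "\<forall>i\<in>{1..2}. \<forall>j\<in>{1..2}. \<forall>z. lie_bracket (X i) (X j) z = 0"
    by (simp add: X_def)
  moreover have "\<forall>i\<in>{1..2}. vector_field_on_quotient ?P (X i)"
    using X1 X2 by (simp add: X_def)
  moreover have "\<forall>i\<in>{1..2}. \<forall>j\<in>{1..1::nat}. \<forall>z. apply_field (X i) F z = 0"
    using F1 F2 by (simp add: X_def)
  moreover have "X 1 = lagrangian_field \<phi>"
    by (simp add: X_def)
  ultimately have "integrable_of_type ?P 2 1 (lagrangian_field \<phi>)"
    unfolding integrable_of_type_def using F indep_F indep_X
    by (intro conjI exI[of _ X] exI[of _ "\<lambda>_. F"]) simp_all
  then show ?thesis
    unfolding liouville_integrable_def by blast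
qed

end
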